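(* Let $G$ be a finite loopless bipartite graph, $u\in V(G)$, and $w:V(G)\to\mathbb{N}$ a weight function with $w(x)\ge 1$ for all $x\in V(G)$. Then the \textsc{NimG-RM} position $(G,u,w)$ is winning for the player to move (mis\`ere outcome $\mathcal{N}$) in mis\`ere convention if and only if every maximum matching of $G$ covers $u$.
   Context: \textsc{NimG-RM} is played on a finite undirected graph $G$ with a weight function $w:V(G)\to\mathbb{N}$ ($w(x)$ tokens on $x$) and a pointer on a starting vertex $u$; position $(G,u,w)$. Players alternate; on his turn a player, with the pointer on $x$, removes at least one token from $x$ and then moves the pointer to a neighbour of $x$. A player who starts his turn on a vertex of weight $0$ (or otherwise cannot move) wins under mis\`ere convention. A matching covers $u$ if some edge of the matching is incident to $u$.
   Formalization: The formal theorem additionally assumes that u has a neighbour; for isolated u the claim is false, since the player to move cannot move and so wins in misère convention, while no maximum matching covers u. *)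

theory Defs
  imports Main
begin

text \<open>
  An undirected graph is a vertex set together with a set of edges, an edge being the set of its
  ends: a two-element set, or a singleton for a loop. Thus the neighbours of a vertex x are the y
  with {x, y} in E, and x is its own neighbour iff it carries a loop. Parallel edges are not
  recorded: they change neither the moves of the game nor the vertices covered by matchings.
\<close>

definition finite_graph :: "'a set \<Rightarrow> 'a set set \<Rightarrow> bool" where
  "finite_graph V E \<longleftrightarrow> finite V \<and> (\<forall>e\<in>E. e \<subseteq> V \<and> card e \<in> {1, 2})"

definition loopless :: "'a set set \<Rightarrow> bool" where
  "loopless E \<longleftrightarrow> (\<forall>x. {x} \<notin> E)"

definition bipartite :: "'a set \<Rightarrow> 'a set set \<Rightarrow> bool" where
  "bipartite V E \<longleftrightarrow>
     (\<exists>A B. A \<union> B = V \<and> A \<inter> B = {} \<and> (\<forall>e\<in>E. \<exists>a\<in>A. \<exists>b\<in>B. e = {a, b}))"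

definition matching :: "'a set set \<Rightarrow> 'a set set \<Rightarrow> bool" where
  "matching E M \<longleftrightarrow> M \<subseteq> E \<and> (\<forall>e\<in>M. \<forall>f\<in>M. e \<noteq> f \<longrightarrow> e \<inter> f = {})"

definition maximum_matching :: "'a set set \<Rightarrow> 'a set set \<Rightarrow> bool" where
  "maximum_matching E M \<longleftrightarrow> matching E M \<and> (\<forall>M'. matching E M' \<longrightarrow> card M' \<le> card M)"

definition covers :: "'a set set \<Rightarrow> 'a \<Rightarrow> bool" where
  "covers M u \<longleftrightarrow> (\<exists>e\<in>M. u \<in> e)"

text \<open>
  A position is the pointer together with the current weights; the graph stays fixed during play.
  There is no move from a vertex of weight 0, nor from a vertex without neighbours.
\<close>

definition nimg_rm_move :: "'a set set \<Rightarrow> 'a \<times> ('a \<Rightarrow> nat) \<Rightarrow> 'a \<times> ('a \<Rightarrow> nat) \<Rightarrow> bool" where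
  "nimg_rm_move E = (\<lambda>(x, w) (y, w'). (\<exists>k < w x. w' = w(x := k)) \<and> {x, y} \<in> E)"

text \<open>
  Outcomes of an impartial game under the misere convention: \<open>misere_N\<close> (\<open>misere_P\<close>) holds of the
  positions from which the player to move (the other player) can force a win. The game is given by
  its move relation.
\<close>

inductive misere_N :: "('p \<Rightarrow> 'p \<Rightarrow> bool) \<Rightarrow> 'p \<Rightarrow> bool"
  and misere_P :: "('p \<Rightarrow> 'p \<Rightarrow> bool) \<Rightarrow> 'p \<Rightarrow> bool"
  for mv :: "'p \<Rightarrow> 'p \<Rightarrow> bool" where
  stuck: "\<forall>q. \<not> mv p q \<Longrightarrow> misere_N mv p"
| winning_move: "mv p q \<Longrightarrow> misere_P mv q \<Longrightarrow> misere_N mv p"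
| all_moves_lose: "\<exists>q. mv p q \<Longrightarrow> \<forall>q. mv p q \<longrightarrow> misere_N mv q \<Longrightarrow> misere_P mv p"

text \<open>
  On an isolated vertex the player to move cannot move and hence wins, although no matching covers
  that vertex. So the matching criterion needs a starting vertex with a neighbour.
\<close>

lemma isolated_misere_N:
  assumes "\<forall>v. {u, v} \<notin> E"
  shows "misere_N (nimg_rm_move E) (u, w)"
  using assms by (intro stuck) (auto simp: nimg_rm_move_def)

lemma isolated_not_covered:
  assumes "finite_graph V E" "\<forall>v. {u, v} \<notin> E" "matching E M"
  shows "\<not> covers M u"
proof
  assume "covers M u"
  then obtain e where e: "e \<in> E" "u \<in> e"
    using assms(3) by (auto simp: covers_def matching_def)
  then have "card e = 1 \<or> card e = 2"
    using assms(1) by (auto simp: finite_graph_def)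
  then have "\<exists>v. e = {u, v}"
    using e(2) by (auto simp: card_1_singleton_iff card_2_iff)
  with e(1) assms(2) show False by auto
qed

end

theory Submission
  imports Defs
begin

text \<open>
  Call a vertex essential if every maximum matching of the subgraph of positive-weight vertices
  covers it. A player on an essential vertex x empties it and follows a maximum matching to y;
  then y is inessential in the remaining graph. A player on an inessential vertex y loses:
  if he empties y, the next vertex z is covered by every maximum matching avoiding y, since
  otherwise the edge yz could be added; if he leaves tokens on y, the vertex z is essential
  because in a bipartite graph two adjacent vertices cannot both be missed by maximum matchings.
  Moving to an empty vertex loses at once.
\<close>

section \<open>Outcome classes of misere play\<close>

text \<open>Both predicates are generated inductively, so disjointness needs a proof: inverting the
  opposite predicate contradicts each rule. This is what turns a \<open>misere_P\<close> verdict
  into the failure of \<open>misere_N\<close>.\<close>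

lemma misere_N_P_exclusive: "misere_N mv p \<Longrightarrow> \<not> misere_P mv p"
  and misere_P_N_exclusive: "misere_P mv p \<Longrightarrow> \<not> misere_N mv p"
proof (induction rule: misere_N_misere_P.inducts)
  case (stuck p)
  then show ?case by (metis misere_P.cases)
next
  case (winning_move p q)
  then show ?case by (metis misere_P.cases)
next
  case (all_moves_lose p)
  then show ?case by (metis misere_N.cases)
qed

section \<open>Elementary facts on matchings\<close>

lemma bipartite_subset:
  assumes "bipartite V E" "F \<subseteq> E"
  shows "bipartite V F"
proof -
  obtain A B where "A \<union> B = V" "A \<inter> B = {}" "\<forall>e\<in>E. \<exists>a\<in>A. \<exists>b\<in>B. e = {a, b}"
    using assms(1) unfolding bipartite_def by blast
  moreover from this(3) have "\<forall>e\<in>F. \<exists>a\<in>A. \<exists>b\<in>B. e = {a, b}"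
    using assms(2) by (meson subsetD)
  ultimately show ?thesis
    unfolding bipartite_def by metis
qed

lemma matching_subset: "matching E M \<Longrightarrow> N \<subseteq> M \<Longrightarrow> matching E N"
  unfolding matching_def by blast

lemma matching_mono: "matching E M \<Longrightarrow> E \<subseteq> F \<Longrightarrow> matching F M"
  unfolding matching_def by blast

lemma finite_matching: "finite E \<Longrightarrow> matching E M \<Longrightarrow> finite M"
  unfolding matching_def by (blast intro: finite_subset)

lemma matching_same_edge:
  "matching E M \<Longrightarrow> e \<in> M \<Longrightarrow> f \<in> M \<Longrightarrow> x \<in> e \<Longrightarrow> x \<in> f \<Longrightarrow> e = f"
  unfolding matching_def by blast

lemma matching_avoiding:
  "matching E M \<Longrightarrow> \<not> covers M x \<Longrightarrow> matching {e \<in> E. x \<notin> e} M"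
  unfolding matching_def covers_def by blast

lemma matching_insert:
  assumes "matching E M" "{x, y} \<in> E" "\<not> covers M x" "\<not> covers M y"
  shows "matching E (insert {x, y} M)"
  using assms unfolding matching_def covers_def by blast

lemma card_matching_insert:
  assumes "finite M" "\<not> covers M x"
  shows "card (insert {x, y} M) = Suc (card M)"
  using assms unfolding covers_def by (intro card_insert_disjoint) auto

lemma maximum_matching_exists:
  assumes "finite E"
  obtains M where "maximum_matching E M"
proof -
  have "{M. matching E M} \<subseteq> Pow E"
    by (auto simp: matching_def)
  then have fin: "finite {M. matching E M}"
    using assms by (simp add: finite_subset)
  have "matching E {}"
    by (simp add: matching_def)
  then have "Max (card ` {M. matching E M}) \<in> card ` {M. matching E M}"
    using fin by (intro Max_in) auto
  then obtain M where M: "matching E M" "Max (card ` {M. matching E M}) = card M"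
    by auto
  have "card M' \<le> card M" if "matching E M'" for M'
    unfolding M(2)[symmetric] using fin that by (intro Max_ge) auto
  with M(1) show thesis
    using that by (auto simp: maximum_matching_def)
qed

section \<open>Maximum matchings that miss given vertices\<close>

text \<open>
  A form of the Mendelsohn--Dulmage theorem. If the edge za lies in M1 and ab in M2, then the
  induction removes the vertices z and a, with b in the role of z.
\<close>

lemma bipartite_matching_missing_both:
  assumes "finite E" "\<forall>e\<in>E. \<exists>a\<in>A. \<exists>b\<in>B. e = {a, b}" "A \<inter> B = {}"
    and "matching E M1" "matching E M2" "card M1 = k" "card M2 = k"
    and "y \<in> A" "z \<in> B" "\<not> covers M1 y" "\<not> covers M2 z"
  shows "\<exists>N. matching E N \<and> (card N = Suc k \<or> card N = k \<and> \<not> covers N y \<and> \<not> covers N z)"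
  using assms
\<comment> \<open>The classes \<open>A\<close>, \<open>B\<close> and the vertex \<open>y\<close>
  stay fixed; everything else changes when two vertices are deleted.\<close>
proof (induction k arbitrary: E M1 M2 z)
  case 0
  then have "M1 = {}"
    using finite_matching by fastforce
  with 0 show ?case
    by (auto simp: covers_def)
next
  case (Suc k)
  note bip = Suc.prems(2,3)
  note fin1 = finite_matching[OF Suc.prems(1,4)] and fin2 = finite_matching[OF Suc.prems(1,5)]
  show ?case
  proof (cases "covers M1 z")
    case False
    \<comment> \<open>\<open>M1\<close> itself misses both vertices.\<close>
    with Suc.prems show ?thesis by blast
  next
    case True
    then obtain e where e: "e \<in> M1" "z \<in> e"
      by (auto simp: covers_def)
    then have "e \<in> E"
      using Suc.prems(4) by (auto simp: matching_def)
    then obtain a b' where "a \<in> A" "b' \<in> B" "e = {a, b'}"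
      using bip(1) by blast
    then have a: "a \<in> A" "e = {a, z}"
      using bip(2) e(2) Suc.prems(9) by auto
    have zaE: "{a, z} \<in> E"
      using \<open>e \<in> E\<close> a(2) by simp
    have "y \<noteq> a"
      using e(1) a(2) Suc.prems(10) by (auto simp: covers_def)
    have "y \<noteq> z" "a \<noteq> z"
      using Suc.prems(8,9) a(1) bip(2) by auto
    show ?thesis
    proof (cases "covers M2 a")
      case False
      \<comment> \<open>\<open>M2\<close> misses both ends of \<open>{a, z}\<close>, so this edge
        augments it.\<close>
      then have "matching E (insert {a, z} M2)"
        using Suc.prems(5,11) zaE by (intro matching_insert)
      moreover have "card (insert {a, z} M2) = Suc (Suc k)"
        using card_matching_insert[OF fin2 False] Suc.prems(7) by simp
      ultimately show ?thesis by blast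
    next
      case True
      then obtain f where f: "f \<in> M2" "a \<in> f"
        by (auto simp: covers_def)
      then have "f \<in> E"
        using Suc.prems(5) by (auto simp: matching_def)
      then obtain a' b where "a' \<in> A" "b \<in> B" "f = {a', b}"
        using bip(1) by blast
      then have b: "b \<in> B" "f = {a, b}"
        using bip(2) f(2) a(1) by auto
      have abE: "{a, b} \<in> E"
        using \<open>f \<in> E\<close> b(2) by simp
      have "b \<noteq> z"
        using f(1) b(2) Suc.prems(11) by (auto simp: covers_def)
      have "b \<noteq> y"
        using Suc.prems(8) b(1) bip(2) by auto
      \<comment> \<open>Deleting \<open>a\<close> and \<open>z\<close> costs \<open>M1\<close> only
        \<open>e\<close>, which joins them, and \<open>M2\<close> only \<open>f\<close>, as
        \<open>M2\<close> misses \<open>z\<close>. Both matchings keep size \<open>k\<close>, and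
        \<open>b\<close> becomes uncovered in the second.\<close>
      define E' where "E' = {g \<in> E. a \<notin> g \<and> z \<notin> g}"
      have m1: "matching E' (M1 - {e})"
        using Suc.prems(4) matching_same_edge[OF Suc.prems(4) e(1)] a(2)
        unfolding matching_def E'_def by blast
      have m2: "matching E' (M2 - {f})"
        using Suc.prems(5,11) matching_same_edge[OF Suc.prems(5) f(1)] b(2)
        unfolding matching_def E'_def covers_def by blast
      have "\<not> covers (M2 - {f}) b"
        using matching_same_edge[OF Suc.prems(5) f(1)] b(2) by (auto simp: covers_def)
      moreover have "\<not> covers (M1 - {e}) y"
        using Suc.prems(10) by (auto simp: covers_def)
      moreover have "finite E'" "\<forall>e\<in>E'. \<exists>a\<in>A. \<exists>b\<in>B. e = {a, b}"
        using Suc.prems(1) bip(1) by (auto simp: E'_def)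
      moreover have "card (M1 - {e}) = k" "card (M2 - {f}) = k"
        using Suc.prems(6,7) e(1) f(1) fin1 fin2 by auto
      ultimately obtain N where N: "matching E' N"
        "card N = Suc k \<or> card N = k \<and> \<not> covers N y \<and> \<not> covers N b"
        using Suc.IH[OF _ _ bip(2) m1 m2 _ _ Suc.prems(8) b(1)] by blast
      have NE: "matching E N"
        using N(1) by (rule matching_mono) (auto simp: E'_def)
      have az: "\<not> covers N a" "\<not> covers N z"
        using N(1) by (auto simp: matching_def covers_def E'_def)
      have finN: "finite N"
        using finite_matching[OF Suc.prems(1) NE] .
      \<comment> \<open>\<open>N\<close> leaves \<open>a\<close> and \<open>z\<close> free. A large
        \<open>N\<close> is extended by \<open>{a, z}\<close>; one that also misses \<open>b\<close>
        is extended by \<open>{a, b}\<close>, which leaves \<open>y\<close> and \<open>z\<close>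
        uncovered.\<close>
      from N(2) show ?thesis
      proof
        assume "card N = Suc k"
        then show ?thesis
          using matching_insert[OF NE zaE az] card_matching_insert[OF finN az(1)] by metis
      next
        assume *: "card N = k \<and> \<not> covers N y \<and> \<not> covers N b"
        have "\<not> covers (insert {a, b} N) y" "\<not> covers (insert {a, b} N) z"
          using * az(2) \<open>y \<noteq> a\<close> \<open>b \<noteq> y\<close> \<open>a \<noteq> z\<close> \<open>b \<noteq> z\<close> by (auto simp: covers_def)
        moreover have "matching E (insert {a, b} N)" "card (insert {a, b} N) = Suc k"
          using * matching_insert[OF NE abE az(1)] card_matching_insert[OF finN az(1)] by auto
        ultimately show ?thesis by blast
      qed
    qed
  qed
qed

text \<open>Otherwise some maximum matching would miss both \<open>y\<close> and \<open>z\<close>,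
  and the edge between them would augment it. This handles moves that leave tokens behind.\<close>

lemma bipartite_maximum_matching_covers_neighbour:
  assumes "finite E" "bipartite V E"
    and "maximum_matching E M" "\<not> covers M y" "{y, z} \<in> E" "maximum_matching E M'"
  shows "covers M' z"
proof (rule ccontr)
  assume z: "\<not> covers M' z"
  obtain A B where AB: "A \<inter> B = {}" "\<forall>e\<in>E. \<exists>a\<in>A. \<exists>b\<in>B. e = {a, b}"
    using assms(2) by (auto simp: bipartite_def)
  have m: "matching E M" "matching E M'" and c: "card M' = card M"
    and max: "\<And>N. matching E N \<Longrightarrow> card N \<le> card M"
    using assms(3,6) by (auto simp: maximum_matching_def intro: le_antisym)
  have "y \<in> A \<and> z \<in> B \<or> z \<in> A \<and> y \<in> B"
    using AB(2) assms(5) by (fastforce simp: doubleton_eq_iff)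
  \<comment> \<open>Two instances, according to the side of the bipartition that contains
    \<open>y\<close>; the second one swaps the two matchings.\<close>
  then obtain N where N: "matching E N"
    "card N = Suc (card M) \<or> card N = card M \<and> \<not> covers N y \<and> \<not> covers N z"
    using bipartite_matching_missing_both[OF assms(1) AB(2,1) m refl c _ _ assms(4) z]
      bipartite_matching_missing_both[OF assms(1) AB(2,1) m(2,1) c refl _ _ z assms(4)]
    by blast
  then have N': "card N = card M" "\<not> covers N y" "\<not> covers N z"
    using max[OF N(1)] by auto
  have "card (insert {y, z} N) = Suc (card M)"
    using card_matching_insert[OF finite_matching[OF assms(1) N(1)] N'(2)] N'(1) by simp
  with max[OF matching_insert[OF N(1) assms(5) N'(2,3)]] show False by simp
qed

text \<open>\<open>M\<close> survives the deletion of \<open>y\<close>, so \<open>M'\<close> is at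
  least as large; if it missed \<open>z\<close>, adding \<open>{y, z}\<close> would exceed the
  maximum in \<open>E\<close>. This handles moves that empty the vertex.\<close>

lemma maximum_matching_delete_covers_neighbour:
  assumes "finite E" "maximum_matching E M" "\<not> covers M y" "{y, z} \<in> E"
    and "maximum_matching {e \<in> E. y \<notin> e} M'"
  shows "covers M' z"
proof (rule ccontr)
  assume z: "\<not> covers M' z"
  have m': "matching {e \<in> E. y \<notin> e} M'"
    using assms(5) by (simp add: maximum_matching_def)
  then have m: "matching E M'" and y: "\<not> covers M' y"
    by (auto simp: matching_def covers_def)
  have "matching {e \<in> E. y \<notin> e} M"
    using assms(2,3) by (simp add: matching_avoiding maximum_matching_def)
  then have "card M \<le> card M'"
    using assms(5) by (simp add: maximum_matching_def)
  moreover have "card (insert {y, z} M') \<le> card M"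
    using assms(2) matching_insert[OF m assms(4) y z] by (simp add: maximum_matching_def)
  ultimately show False
    using card_matching_insert[OF finite_matching[OF assms(1) m] y] by simp
qed

text \<open>A matching avoiding an essential vertex is not maximum in \<open>E\<close>, so it has at
  least one edge fewer than \<open>M\<close>; \<open>M - {e}\<close> attains this bound.\<close>

lemma maximum_matching_delete_essential:
  assumes "finite E" "maximum_matching E M" "e \<in> M" "x \<in> e"
    and ess: "\<forall>M'. maximum_matching E M' \<longrightarrow> covers M' x"
  shows "maximum_matching {f \<in> E. x \<notin> f} (M - {e})"
  unfolding maximum_matching_def
proof (intro conjI allI impI)
  have m: "matching E M"
    using assms(2) by (simp add: maximum_matching_def)
  have "\<not> covers (M - {e}) x"
    using matching_same_edge[OF m assms(3) _ assms(4)] by (auto simp: covers_def)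
  with matching_subset[OF m, of "M - {e}"] show "matching {f \<in> E. x \<notin> f} (M - {e})"
    by (intro matching_avoiding) auto
  fix M' assume M': "matching {f \<in> E. x \<notin> f} M'"
  then have m': "matching E M'" and "\<not> covers M' x"
    by (auto simp: matching_def covers_def)
  then have "\<not> maximum_matching E M'"
    using ess by blast
  then have "card M' < card M"
    using m' assms(2) unfolding maximum_matching_def by (meson le_trans not_le_imp_less)
  then show "card M' \<le> card (M - {e})"
    using assms(3) finite_matching[OF assms(1) m] by simp
qed

section \<open>The live graph and the outcome of a position\<close>

text \<open>Emptied vertices become isolated instead of being removed: the matchings are those of
  the subgraph induced on positive weights, and \<open>V\<close> need not change during
  play.\<close>

definition live_edges :: "'a set set \<Rightarrow> ('a \<Rightarrow> nat) \<Rightarrow> 'a set set" where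
  "live_edges E w = {e \<in> E. \<forall>v\<in>e. 0 < w v}"

lemma live_edges_empty_vertex: "live_edges E (w(x := 0)) = {e \<in> live_edges E w. x \<notin> e}"
  by (auto simp: live_edges_def)

lemma live_edges_keep_vertex:
  "0 < w x \<Longrightarrow> 0 < k \<Longrightarrow> live_edges E (w(x := k)) = live_edges E w"
  by (auto simp: live_edges_def)

lemma misere_N_empty_vertex: "w x = 0 \<Longrightarrow> misere_N (nimg_rm_move E) (x, w)"
  by (intro stuck) (auto simp: nimg_rm_move_def)

text \<open>Play does not preserve positivity of all weights, so only the pointer's weight is
  required to be positive. The neighbour is taken in \<open>E\<close>, as it may already be empty.
  Deciding both outcomes at once lets one induction on the number of tokens serve both
  players.\<close>

lemma nimg_rm_outcome:
  assumes G: "finite_graph V E" "loopless E" "bipartite V E"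
    and "x \<in> V" "\<exists>v. {x, v} \<in> E" "0 < w x"
  shows "if \<forall>M. maximum_matching (live_edges E w) M \<longrightarrow> covers M x
    then misere_N (nimg_rm_move E) (x, w) else misere_P (nimg_rm_move E) (x, w)"
  using assms(4-)
proof (induction "sum w V" arbitrary: x w rule: less_induct)
  case less
  let ?F = "live_edges E w"
  have finV: "finite V" and edge: "\<And>e. e \<in> E \<Longrightarrow> e \<subseteq> V"
    using G(1) by (auto simp: finite_graph_def)
  have "E \<subseteq> Pow V"
    using edge by auto
  then have finF: "finite ?F"
    using finV by (auto simp: live_edges_def intro: finite_subset)
  have bipF: "bipartite V ?F"
    using G(3) by (rule bipartite_subset) (auto simp: live_edges_def)
  \<comment> \<open>Hence removing tokens from \<open>x\<close> does not alter the weight of the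
    next vertex.\<close>
  have noloop: "y \<noteq> x" if "{x, y} \<in> E" for y
    using that G(2) by (auto simp: loopless_def)
  have decr: "sum (w(x := k)) V < sum w V" if "k < w x" for k
    using finV less.prems(1) that by (intro sum_strict_mono_ex1) auto
  have IH: "if \<forall>M. maximum_matching (live_edges E (w(x := k))) M \<longrightarrow> covers M y
      then misere_N (nimg_rm_move E) (y, w(x := k))
      else misere_P (nimg_rm_move E) (y, w(x := k))"
    if "k < w x" "{x, y} \<in> E" "0 < w y" for k y
  proof (rule less.hyps)
    show "sum (w(x := k)) V < sum w V"
      using that(1) by (rule decr)
    show "y \<in> V"
      using edge[OF that(2)] by simp
    show "\<exists>v. {y, v} \<in> E"
      using that(2) by (metis insert_commute)
    show "0 < (w(x := k)) y"
      using that(3) noloop[OF that(2)] by simp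
  qed
  show ?case
  proof (cases "\<forall>M. maximum_matching ?F M \<longrightarrow> covers M x")
    case True
    obtain M where M: "maximum_matching ?F M"
      using maximum_matching_exists[OF finF] .
    then obtain e where e: "e \<in> M" "x \<in> e"
      using True by (auto simp: covers_def)
    have m: "matching ?F M"
      using M by (simp add: maximum_matching_def)
    with e(1) have eF: "e \<in> ?F"
      by (auto simp: matching_def)
    then obtain a b where ab: "e = {a, b}"
      using bipF unfolding bipartite_def by meson
    obtain y where y: "e = {x, y}"
      using ab e(2) by blast
    have yE: "{x, y} \<in> E" "0 < w y"
      using eF y by (auto simp: live_edges_def)
    have "\<not> covers (M - {e}) y"
      using matching_same_edge[OF m e(1), of _ y] y by (auto simp: covers_def)
    moreover have "maximum_matching (live_edges E (w(x := 0))) (M - {e})"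
      using maximum_matching_delete_essential[OF finF M e True]
      by (simp add: live_edges_empty_vertex)
    ultimately have "misere_P (nimg_rm_move E) (y, w(x := 0))"
      using IH[OF less.prems(3) yE] by (auto split: if_splits)
    moreover have "nimg_rm_move E (x, w) (y, w(x := 0))"
      using less.prems(3) yE(1) by (auto simp: nimg_rm_move_def)
    ultimately show ?thesis
      using True by (auto intro: winning_move)
  next
    case False
    then obtain M where M: "maximum_matching ?F M" "\<not> covers M x"
      by blast
    have "misere_N (nimg_rm_move E) (z, w(x := k))" if k: "k < w x" and z: "{x, z} \<in> E" for k z
    proof (cases "w z = 0")
      case True
      with noloop[OF z] show ?thesis
        by (intro misere_N_empty_vertex) simp
    next
      case False
      then have zF: "{x, z} \<in> ?F"
        using z less.prems(3) by (simp add: live_edges_def)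
      have "covers M' z" if M': "maximum_matching (live_edges E (w(x := k))) M'" for M'
      proof (cases "k = 0")
        case True
        with M' show ?thesis
          using maximum_matching_delete_covers_neighbour[OF finF M zF]
          by (simp add: live_edges_empty_vertex)
      next
        case False
        with M' show ?thesis
          using bipartite_maximum_matching_covers_neighbour[OF finF bipF M zF] less.prems(3)
          by (simp add: live_edges_keep_vertex)
      qed
      then show ?thesis
        using IH[OF k z] False by simp
    qed
    then have "\<forall>q. nimg_rm_move E (x, w) q \<longrightarrow> misere_N (nimg_rm_move E) q"
      by (auto simp: nimg_rm_move_def)
    moreover have "\<exists>q. nimg_rm_move E (x, w) q"
      using less.prems(2,3) by (auto simp: nimg_rm_move_def)
    ultimately have "misere_P (nimg_rm_move E) (x, w)"
      by (intro all_moves_lose)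
    then show ?thesis
      by (subst if_not_P[OF False])
  qed
qed

theorem theorem7:
  fixes V :: "'a set" and E :: "'a set set" and u :: 'a and w :: "'a \<Rightarrow> nat"
  assumes "finite_graph V E" and "loopless E" and "bipartite V E"
    and "u \<in> V"
    and "\<exists>v. {u, v} \<in> E"
    and "\<forall>x\<in>V. w x \<ge> 1"
  shows "misere_N (nimg_rm_move E) (u, w) \<longleftrightarrow> (\<forall>M. maximum_matching E M \<longrightarrow> covers M u)"
proof -
  have "live_edges E w = E"
    using assms(1,6) by (fastforce simp: live_edges_def finite_graph_def)
  moreover have "0 < w u"
    using assms(4,6) by fastforce
  ultimately have "if \<forall>M. maximum_matching E M \<longrightarrow> covers M u
    then misere_N (nimg_rm_move E) (u, w) else misere_P (nimg_rm_move E) (u, w)"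
    using nimg_rm_outcome[OF assms(1-5), of w] by simp
  then show ?thesis
    using misere_N_P_exclusive by (metis (no_types))
qed

end
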